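(* Let $\Omega\subseteq\mathbb{C}$ be open, $F$ analytic on $\Omega$, $g$ antisymmetric and $f\in\mathrm{Ker}\,\mathcal{L}^{(g)}_3$. Let $\{b_i\}_{i\ge0}\subseteq\Omega$ be a sequence of pairwise distinct points and $\{x_i\}_{i\ge 0}$ a sequence of complex numbers such that none of the denominators below vanish. Let $$S_n(x)=\sum_{k=0}^{n}G(k)\,f(x_k,b_k)\,\frac{\prod_{i=0}^{k-1}g(b_i,x)}{\prod_{i=1}^{k}f(x_i,x)},\qquad G(k)=\mathbb{D}^{(k)}_{(f,g)}\left[\begin{matrix}b_0,b_1,\dots,b_k\\ x_1,\dots,x_{k-1}\end{matrix}\right]\{F(x)\}.$$ Assume further that (i) $\lim_{n\to\infty}b_n=b\in\Omega$; (ii) $S_n(x)$ converges uniformly to $S(x)$ in a neighborhood of $b$; (iii) for every integer $i\ge 0$, the function $x\mapsto g(b_i,x)/f(x_{i+1},x)$ is analytic at $x=b$. Then there exists a subset $\Omega_1\subseteq\Omega$ containing $b$ such that for all $x\in\Omega_1$, $$F(x)=S(x)=\sum_{k=0}^{\infty}G(k)\,f(x_k,b_k)\,\frac{\prod_{i=0}^{k-1}g(b_i,x)}{\prod_{i=1}^{k}f(x_i,x)}.$$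
   Context: For an antisymmetric function $g(x,y)=-g(y,x)$ of two complex variables, $\mathrm{Ker}\,\mathcal{L}^{(g)}_3$ is the set of functions $f(x,y)$ of two complex variables such that for all $a,b,c,x\in\mathbb{C}$: $f(x,a)g(b,c)+f(x,b)g(c,a)+f(x,c)g(a,b)=0$. The $k$-th order $(f,g)$-difference of $F$ is $$\mathbb{D}^{(k)}_{(f,g)}\left[\begin{matrix}b_0,b_1,\dots,b_k\\ x_1,\dots,x_{k-1}\end{matrix}\right]\{F(x)\}=\sum_{j=0}^{k}F(b_j)\frac{\prod_{i=1}^{k-1}f(x_i,b_j)}{\prod_{i=0,\,i\ne j}^{k}g(b_i,b_j)},$$ with empty numerator product ($=1$) for $k=1$, and with value $F(b_0)/f(x_0,b_0)$ for $k=0$. *)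

theory Defs
  imports "HOL-Complex_Analysis.Complex_Analysis"
begin

definition antisymmetric :: "(complex \<Rightarrow> complex \<Rightarrow> complex) \<Rightarrow> bool" where
  "antisymmetric g \<longleftrightarrow> (\<forall>x y. g x y = - g y x)"

definition Ker_L3 :: "(complex \<Rightarrow> complex \<Rightarrow> complex) \<Rightarrow> (complex \<Rightarrow> complex \<Rightarrow> complex) set" where
  "Ker_L3 g = {f. \<forall>a b c x. f x a * g b c + f x b * g c a + f x c * g a b = 0}"

text \<open>
  The \<open>k\<close>-th order \<open>(f,g)\<close>-difference of \<open>F\<close>. The nodes \<open>b\<close> and parameters \<open>x\<close> are passed as
  whole sequences, of which only \<open>b 0, \<dots>, b k\<close> and \<open>x 1, \<dots>, x (k - 1)\<close> are used, except that
  order \<open>0\<close> uses \<open>x 0\<close>.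
\<close>

definition fg_difference ::
  "(complex \<Rightarrow> complex \<Rightarrow> complex) \<Rightarrow> (complex \<Rightarrow> complex \<Rightarrow> complex) \<Rightarrow>
   nat \<Rightarrow> (nat \<Rightarrow> complex) \<Rightarrow> (nat \<Rightarrow> complex) \<Rightarrow> (complex \<Rightarrow> complex) \<Rightarrow> complex" where
  "fg_difference f g k b x F =
     (if k = 0 then F (b 0) / f (x 0) (b 0)
      else \<Sum>j\<le>k. F (b j) * ((\<Prod>i=1..k-1. f (x i) (b j)) / (\<Prod>i\<in>{..k}-{j}. g (b i) (b j))))"

definition fg_term ::
  "(complex \<Rightarrow> complex \<Rightarrow> complex) \<Rightarrow> (complex \<Rightarrow> complex \<Rightarrow> complex) \<Rightarrow>
   (nat \<Rightarrow> complex) \<Rightarrow> (nat \<Rightarrow> complex) \<Rightarrow> (complex \<Rightarrow> complex) \<Rightarrow> nat \<Rightarrow> complex \<Rightarrow> complex" where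
  "fg_term f g b x F k z =
     fg_difference f g k b x F * f (x k) (b k) *
     ((\<Prod>i<k. g (b i) z) / (\<Prod>i=1..k. f (x i) z))"

end

theory Submission
  imports Defs
begin

text \<open>
  The partial sums \<open>S\<^sub>n\<close> are interpolants: \<open>S\<^sub>n\<close> agrees with \<open>F\<close> at every node \<open>b\<^sub>m\<close> with \<open>m \<le> n\<close>
  that lies in \<open>U\<close>. This is an inversion of triangular matrices, and the three-term relation that
  defines the kernel makes the sums that occur in it telescope (lemma
  \<open>fg_partial_sum_interpolates\<close>). Hence the limit \<open>S\<close> agrees with \<open>F\<close> at all but finitely many
  nodes, and the nodes accumulate at \<open>blim\<close>. So the identity theorem gives \<open>F = S\<close> near \<open>blim\<close>, as
  soon as \<open>S\<close> is known to be holomorphic there.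

  The holomorphy of \<open>S\<close> is the delicate point: each ratio \<open>g(b\<^sub>i,z)/f(x\<^sub>i\<^sub>+\<^sub>1,z)\<close> is analytic in
  some neighbourhood of \<open>blim\<close>, but a priori these neighbourhoods could shrink to the point \<open>blim\<close>
  as \<open>i\<close> grows, and then uniform convergence would say nothing. The three-term relation excludes
  this. It forces all the functions \<open>f(X,\<cdot>)\<close> and \<open>g(c,\<cdot>)\<close> to lie in one space of dimension two. If
  for some \<open>i\<close> the functions \<open>g(b\<^sub>i,\<cdot>)\<close> and \<open>f(x\<^sub>i\<^sub>+\<^sub>1,\<cdot>)\<close> form a basis of it, their ratio \<open>r\<close>
  determines all the others as fractions \<open>(\<alpha> r + \<beta>)/(\<gamma> r + \<delta>)\<close>, whose denominators
  vanish nowhere on \<open>U\<close> because the functions \<open>f(x\<^sub>i,\<cdot>)\<close> with \<open>i \<ge> 1\<close> do not. One neighbourhood on which \<open>r\<close> is holomorphic therefore serves for all the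
  ratios. If no \<open>i\<close> gives a basis, every ratio is constant (lemma \<open>ratios_common_domain\<close>).
\<close>

section \<open>The three-term relation\<close>

lemma Ker_L3D:
  assumes "f \<in> Ker_L3 g"
  shows "f u a * g b c + f u b * g c a + f u c * g a b = 0"
  using assms by (simp add: Ker_L3_def)

lemma antisymmetricD: "antisymmetric g \<Longrightarrow> g u v = - g v u"
  unfolding antisymmetric_def by blast

lemma antisymmetric_diag: "antisymmetric g \<Longrightarrow> g u u = 0"
proof -
  assume "antisymmetric g"
  then have "g u u = - g u u" by (rule antisymmetricD)
  then have "2 * g u u = 0" by (metis add.right_inverse mult_2)
  then show ?thesis by simp
qed

text \<open>
  The numerator that turns the coefficients of the \<open>k\<close>-th term into a difference of two consecutive
  quantities of the same shape: \<open>c\<close> and \<open>u\<close> will be \<open>b k\<close> and \<open>x k\<close>.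
\<close>

lemma Ker_L3_split:
  assumes "antisymmetric g" "f \<in> Ker_L3 g"
  shows "f u c * g y z = f u y * g c z - f u z * g c y"
  using Ker_L3D[OF assms(2), of u c y z] antisymmetricD[OF assms(1), of z c]
  by (simp add: algebra_simps)

section \<open>Interpolation at the nodes\<close>

text \<open>
  The coefficient of \<open>F (b j)\<close> in the \<open>k\<close>-th term of the series. Order \<open>0\<close> is separate because the
  factor \<open>f (x 0) (b 0)\<close> of that term cancels the denominator of the difference of order \<open>0\<close>.
\<close>

definition fg_coefficient ::
  "(complex \<Rightarrow> complex \<Rightarrow> complex) \<Rightarrow> (complex \<Rightarrow> complex \<Rightarrow> complex) \<Rightarrow>
   (nat \<Rightarrow> complex) \<Rightarrow> (nat \<Rightarrow> complex) \<Rightarrow> nat \<Rightarrow> nat \<Rightarrow> complex \<Rightarrow> complex" where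
  "fg_coefficient f g b x k j z =
     (if k = 0 then 1 else (\<Prod>i=1..k-1. f (x i) (b j)) * f (x k) (b k))
       / (\<Prod>i\<in>{..k}-{j}. g (b i) (b j))
       * ((\<Prod>i<k. g (b i) z) / (\<Prod>i=1..k. f (x i) z))"

lemma fg_term_eq_sum_coefficient:
  assumes "f (x 0) (b 0) \<noteq> 0"
  shows "fg_term f g b x F k z = (\<Sum>j\<le>k. F (b j) * fg_coefficient f g b x k j z)"
proof (cases "k = 0")
  case True
  then show ?thesis
    using assms by (simp add: fg_term_def fg_difference_def fg_coefficient_def)
next
  case False
  then show ?thesis
    unfolding fg_term_def fg_difference_def fg_coefficient_def
    by (simp add: sum_distrib_right sum_distrib_left mult_ac)
qed

text \<open>
  After multiplication by \<open>g (b j) z\<close>, the three-term relation at \<open>b k, b j, z\<close> writes the \<open>k\<close>-th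
  coefficient as the difference of the right-hand sides for \<open>n = k\<close> and \<open>n = k - 1\<close>.
\<close>

lemma fg_coefficient_sum_telescopes:
  assumes g: "antisymmetric g" and f: "f \<in> Ker_L3 g"
    and nz_g: "\<And>i j. i \<noteq> j \<Longrightarrow> g (b i) (b j) \<noteq> 0"
    and nz_f: "\<And>i. i \<ge> 1 \<Longrightarrow> f (x i) z \<noteq> 0"
    and "j \<le> n"
  shows "(\<Sum>k=j..n. fg_coefficient f g b x k j z) * g (b j) z =
           (\<Prod>i=1..n. f (x i) (b j)) * (\<Prod>i\<le>n. g (b i) z)
             / ((\<Prod>i\<in>{..n}-{j}. g (b i) (b j)) * (\<Prod>i=1..n. f (x i) z))"
  using \<open>j \<le> n\<close>
proof (induction n rule: dec_induct)
  case base
  show ?case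
  proof (cases j)
    case 0
    then show ?thesis by (simp add: fg_coefficient_def)
  next
    case (Suc j')
    then show ?thesis
      by (simp add: fg_coefficient_def lessThan_Suc_atMost[symmetric])
  qed
next
  case (step n)
  define P where "P = (\<Prod>i=1..n. f (x i) (b j))"
  define Q where "Q = (\<Prod>i\<le>n. g (b i) z)"
  define R where "R = (\<Prod>i\<in>{..n}-{j}. g (b i) (b j))"
  define T where "T = (\<Prod>i=1..n. f (x i) z)"
  let ?m = "Suc n"
  have nz: "R \<noteq> 0" "T \<noteq> 0" "g (b ?m) (b j) \<noteq> 0" "f (x ?m) z \<noteq> 0"
    using nz_g nz_f step.hyps by (auto simp: R_def T_def)
  have "{..?m} - {j} = insert ?m ({..n} - {j})"
    using step.hyps by auto
  then have R': "(\<Prod>i\<in>{..?m}-{j}. g (b i) (b j)) = g (b ?m) (b j) * R"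
    by (simp add: R_def)
  have coeff: "fg_coefficient f g b x ?m j z =
      P * f (x ?m) (b ?m) / (g (b ?m) (b j) * R) * (Q / (T * f (x ?m) z))"
    unfolding fg_coefficient_def R'
    by (simp add: P_def Q_def T_def lessThan_Suc_atMost)
  have "(\<Sum>k=j..?m. fg_coefficient f g b x k j z) * g (b j) z =
      P * Q / (R * T) + fg_coefficient f g b x ?m j z * g (b j) z"
    using step by (simp add: distrib_right P_def Q_def R_def T_def)
  also have "fg_coefficient f g b x ?m j z * g (b j) z =
      P * Q * (f (x ?m) (b ?m) * g (b j) z) / (g (b ?m) (b j) * R * (T * f (x ?m) z))"
    by (simp add: coeff)
  also have "f (x ?m) (b ?m) * g (b j) z =
      f (x ?m) (b j) * g (b ?m) z - f (x ?m) z * g (b ?m) (b j)"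
    by (rule Ker_L3_split[OF g f])
  also have "P * Q / (R * T) + P * Q * (f (x ?m) (b j) * g (b ?m) z - f (x ?m) z * g (b ?m) (b j))
        / (g (b ?m) (b j) * R * (T * f (x ?m) z)) =
      (P * f (x ?m) (b j)) * (Q * g (b ?m) z) / ((g (b ?m) (b j) * R) * (T * f (x ?m) z))"
    using nz by (simp add: field_simps)
  finally show ?case
    unfolding R' by (simp add: P_def Q_def T_def)
qed

text \<open>
  At \<open>z = b m\<close> the telescoped sum contains the factor \<open>g (b m) (b m) = 0\<close>. Division
  by \<open>g (b j) (b m)\<close> is possible unless \<open>j = m\<close>, and then the sum has just one entry.
\<close>

lemma fg_coefficient_sum_at_node:
  assumes g: "antisymmetric g" and f: "f \<in> Ker_L3 g"
    and nz_g: "\<And>i j. i \<noteq> j \<Longrightarrow> g (b i) (b j) \<noteq> 0"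
    and nz_f: "\<And>i. i \<ge> 1 \<Longrightarrow> f (x i) (b m) \<noteq> 0"
    and "j \<le> m"
  shows "(\<Sum>k=j..m. fg_coefficient f g b x k j (b m)) = (if j = m then 1 else 0)"
proof (cases "j = m")
  case True
  have set: "{..m} - {m} = {..<m}" by auto
  have "(\<Prod>i<m. g (b i) (b m)) \<noteq> 0" "(\<Prod>i=1..m. f (x i) (b m)) \<noteq> 0"
    using nz_g nz_f by auto
  then have "fg_coefficient f g b x m m (b m) = 1"
    unfolding fg_coefficient_def set by (cases m) simp_all
  with True show ?thesis by simp
next
  case False
  have "(\<Prod>i\<le>m. g (b i) (b m)) = 0"
    using antisymmetric_diag[OF g] by auto
  then have "(\<Sum>k=j..m. fg_coefficient f g b x k j (b m)) * g (b j) (b m) = 0"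
    using fg_coefficient_sum_telescopes[where b = b and x = x and z = "b m", OF g f nz_g nz_f \<open>j \<le> m\<close>] by simp
  with False nz_g show ?thesis by simp
qed

lemma fg_partial_sum_interpolates:
  assumes g: "antisymmetric g" and f: "f \<in> Ker_L3 g"
    and nz_g: "\<And>i j. i \<noteq> j \<Longrightarrow> g (b i) (b j) \<noteq> 0"
    and nz_f0: "f (x 0) (b 0) \<noteq> 0"
    and nz_f: "\<And>i. i \<ge> 1 \<Longrightarrow> f (x i) (b m) \<noteq> 0"
    and "m \<le> n"
  shows "(\<Sum>k\<le>n. fg_term f g b x F k (b m)) = F (b m)"
proof -
  have zero: "fg_term f g b x F k (b m) = 0" if "m < k" for k
  proof -
    have "(\<Prod>i<k. g (b i) (b m)) = 0"
      using that antisymmetric_diag[OF g] by auto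
    then show ?thesis by (simp add: fg_term_def)
  qed
  have "(\<Sum>k\<le>n. fg_term f g b x F k (b m)) = (\<Sum>k\<le>m. fg_term f g b x F k (b m))"
    using \<open>m \<le> n\<close> zero by (intro sum.mono_neutral_right) auto
  also have "\<dots> = (\<Sum>k\<le>m. \<Sum>j\<in>{j\<in>{..m}. j \<le> k}. F (b j) * fg_coefficient f g b x k j (b m))"
    by (intro sum.cong refl, subst fg_term_eq_sum_coefficient[where f = f and x = x and b = b, OF nz_f0], intro sum.cong) auto
  also have "\<dots> = (\<Sum>j\<le>m. \<Sum>k\<in>{k\<in>{..m}. j \<le> k}. F (b j) * fg_coefficient f g b x k j (b m))"
    by (rule sum.swap_restrict) auto
  also have "\<dots> = (\<Sum>j\<le>m. F (b j) * (\<Sum>k=j..m. fg_coefficient f g b x k j (b m)))"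
    unfolding sum_distrib_left by (intro sum.cong) auto
  also have "\<dots> = (\<Sum>j\<le>m. F (b j) * (if j = m then 1 else 0))"
    by (intro sum.cong refl) (simp add: fg_coefficient_sum_at_node[where b = b and x = x and m = m, OF g f nz_g nz_f])
  also have "\<dots> = F (b m)"
    by (simp add: if_distrib[of "(*) _"] cong: if_cong)
  finally show ?thesis .
qed

section \<open>A common domain of holomorphy\<close>

text \<open>
  The condition \<open>f u c \<noteq> 0\<close> makes \<open>f u\<close> and \<open>g c\<close> independent whenever \<open>g c\<close> is not
  identically zero, because \<open>g c\<close> vanishes at \<open>c\<close>; they then span the two-dimensional space. The functions \<open>f v\<close> enter the relation
  only with the factor \<open>g c d\<close>, hence a point \<open>d\<close> where \<open>g c\<close> is nonzero is required for them.
\<close>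

lemma Ker_L3_span_g:
  assumes "antisymmetric g" "f \<in> Ker_L3 g" "f u c \<noteq> 0"
  shows "g a z = (f u a / f u c) * g c z + (g a c / f u c) * f u z"
proof -
  have "f u c * g a z = f u a * g c z - f u z * g c a"
    by (rule Ker_L3_split[OF assms(1,2)])
  then show ?thesis
    using assms(3) antisymmetricD[OF assms(1), of c a] by (simp add: field_simps)
qed

lemma Ker_L3_span_f:
  assumes "antisymmetric g" "f \<in> Ker_L3 g" "f u c \<noteq> 0" "g c d \<noteq> 0"
  obtains \<alpha> \<beta> where "\<And>z. f v z = \<alpha> * g c z + \<beta> * f u z"
proof
  fix z
  have "f v c * g d z = f v d * g c z - f v z * g c d"
    by (rule Ker_L3_split[OF assms(1,2)])
  moreover have "g d z = (f u d / f u c) * g c z + (g d c / f u c) * f u z"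
    by (rule Ker_L3_span_g[OF assms(1-3)])
  ultimately have "f v z * g c d =
      f v d * g c z - f v c * ((f u d / f u c) * g c z + (g d c / f u c) * f u z)"
    by (simp add: algebra_simps)
  then have "f v z =
      (f v d * g c z - f v c * ((f u d / f u c) * g c z + (g d c / f u c) * f u z)) / g c d"
    using assms(4) by (simp add: nonzero_eq_divide_eq)
  also have "\<dots> = ((f v d - f v c * f u d / f u c) / g c d) * g c z
      + (- f v c * g d c / f u c / g c d) * f u z"
    by (simp add: diff_divide_distrib add_divide_distrib algebra_simps)
  finally show "f v z = \<dots>" .
qed

text \<open>
  The degenerate case, in which \<open>f u\<close> and \<open>g c\<close> are proportional and yield no basis. If every
  ratio is of this kind, then all of them are constant, hence holomorphic everywhere.
\<close>

lemma Ker_L3_ratio_constant: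
  assumes "antisymmetric g" "f \<in> Ker_L3 g" "f u c = 0" "g c d \<noteq> 0" "f u z \<noteq> 0"
  shows "g c z / f u z = g c d / f u d"
proof -
  have *: "f u d * g c z = f u z * g c d"
    using Ker_L3_split[OF assms(1,2), of u c d z] Ker_L3_split[OF assms(1,2), of u d c z] assms(3)
      antisymmetricD[OF assms(1), of d c] by simp
  with assms(4,5) have "f u d \<noteq> 0" by auto
  with * assms(5) show ?thesis by (simp add: field_simps)
qed

text \<open>
  Either every ratio is constant, or some pair \<open>g (b i)\<close>, \<open>f (y i)\<close> is a basis, in which every
  other ratio becomes a fractional linear function of the ratio \<open>r\<close> of this pair. The zeros of its
  denominator would be zeros of some \<open>f (y j)\<close>, so a neighbourhood good for \<open>r\<close> is good for all.
\<close>

lemma ratios_common_domain: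
  fixes b y :: "nat \<Rightarrow> complex"
  assumes g: "antisymmetric g" and f: "f \<in> Ker_L3 g"
    and nz_g: "\<And>i j. i \<noteq> j \<Longrightarrow> g (b i) (b j) \<noteq> 0"
    and nz_f: "\<And>i z. z \<in> U \<Longrightarrow> f (y i) z \<noteq> 0"
    and "open U" "p \<in> U"
    and an: "\<And>i. (\<lambda>z. g (b i) z / f (y i) z) analytic_on {p}"
  obtains W where "open W" "p \<in> W" "W \<subseteq> U"
    "\<And>i. (\<lambda>z. g (b i) z / f (y i) z) holomorphic_on W"
proof (cases "\<exists>i. f (y i) (b i) \<noteq> 0")
  case False
  have "(\<lambda>z. g (b i) z / f (y i) z) holomorphic_on U" for i
  proof (rule holomorphic_transform[OF holomorphic_on_const])
    fix z assume "z \<in> U"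
    then show "g (b i) (b (Suc i)) / f (y i) (b (Suc i)) = g (b i) z / f (y i) z"
      using False nz_f nz_g by (intro Ker_L3_ratio_constant[OF g f, symmetric]) auto
  qed
  with assms(5,6) that show ?thesis by blast
next
  case True
  then obtain i where i: "f (y i) (b i) \<noteq> 0" by blast
  define r where "r z = g (b i) z / f (y i) z" for z
  obtain V where V: "open V" "p \<in> V" "r holomorphic_on V"
    using an[of i] unfolding r_def analytic_at by blast
  have r: "g (b i) z = r z * f (y i) z" if "z \<in> U" for z
    using nz_f[OF that] by (simp add: r_def)
  have "(\<lambda>z. g (b j) z / f (y j) z) holomorphic_on V \<inter> U" for j
  proof -
    obtain \<gamma> \<delta> where den: "\<And>z. f (y j) z = \<gamma> * g (b i) z + \<delta> * f (y i) z"
      using Ker_L3_span_f[OF g f i nz_g[of i "Suc i"]] by auto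
    define \<alpha> where "\<alpha> = f (y i) (b j) / f (y i) (b i)"
    define \<beta> where "\<beta> = g (b j) (b i) / f (y i) (b i)"
    have num: "g (b j) z = \<alpha> * g (b i) z + \<beta> * f (y i) z" for z
      unfolding \<alpha>_def \<beta>_def by (rule Ker_L3_span_g[OF g f i])
    have den': "f (y j) z = (\<gamma> * r z + \<delta>) * f (y i) z"
      and num': "g (b j) z = (\<alpha> * r z + \<beta>) * f (y i) z" if "z \<in> U" for z
      using den[of z] num[of z] r[OF that] by (simp_all add: algebra_simps)
    have nz: "\<gamma> * r z + \<delta> \<noteq> 0" if "z \<in> U" for z
      using den'[OF that] nz_f[OF that, of j] by auto
    have "r holomorphic_on V \<inter> U"
      using V(3) by (rule holomorphic_on_subset) auto
    then have "(\<lambda>z. (\<alpha> * r z + \<beta>) / (\<gamma> * r z + \<delta>)) holomorphic_on V \<inter> U"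
      using nz by (intro holomorphic_intros) auto
    then show ?thesis
      using num' den' nz_f by (elim holomorphic_transform) auto
  qed
  with V assms(5,6) show ?thesis
    by (intro that[of "V \<inter> U"]) auto
qed

section \<open>Expansion of analytic functions\<close>

lemma fg_term_eq_prod_ratios:
  "fg_term f g b x F k z =
     fg_difference f g k b x F * f (x k) (b k) * (\<Prod>i<k. g (b i) z / f (x (i + 1)) z)"
proof -
  have "(\<Prod>i=1..k. f (x i) z) = (\<Prod>i<k. f (x (i + 1)) z)"
    using prod.shift_bounds_Suc_ivl[of "\<lambda>i. f (x i) z" 0 k]
    by (simp add: atLeastLessThanSuc_atLeastAtMost lessThan_atLeast0)
  then show ?thesis
    by (simp add: fg_term_def prod_dividef)
qed

lemma inj_tendsto_islimpt:
  fixes b :: "nat \<Rightarrow> 'a :: first_countable_topology"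
  assumes "inj b" "b \<longlonglongrightarrow> l" and "\<And>n. n \<ge> N \<Longrightarrow> b n \<in> A"
  shows "l islimpt A"
proof -
  \<comment> \<open>By injectivity at most one node equals the limit, so a tail of the sequence avoids it.\<close>
  obtain M where M: "\<And>n. n \<ge> M \<Longrightarrow> b n \<noteq> l"
  proof (cases "\<exists>k. b k = l")
    case True
    then obtain k where k: "b k = l" by blast
    then have "b n \<noteq> l" if "n \<ge> Suc k" for n
      using that injD[OF assms(1), of n k] by auto
    then show ?thesis by (rule that)
  qed auto
  have "(\<lambda>n. b (n + (M + N))) \<longlonglongrightarrow> l"
    using assms(2) by (rule LIMSEQ_ignore_initial_segment)
  then show ?thesis
    unfolding islimpt_sequential using M assms(3)
    by (intro exI[of _ "\<lambda>n. b (n + (M + N))"]) auto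
qed

theorem theorem3p1:
  fixes \<Omega> U :: "complex set"
    and F S :: "complex \<Rightarrow> complex"
    and f g :: "complex \<Rightarrow> complex \<Rightarrow> complex"
    and b x :: "nat \<Rightarrow> complex"
    and blim :: complex
  assumes "open \<Omega>"
    and "F analytic_on \<Omega>"
    and "antisymmetric g"
    and "f \<in> Ker_L3 g"
    and "range b \<subseteq> \<Omega>"
    and "inj b"
    and "open U" and "blim \<in> U"
    and denom_g: "\<And>i j. i \<noteq> j \<Longrightarrow> g (b i) (b j) \<noteq> 0"
    and denom_f0: "f (x 0) (b 0) \<noteq> 0"
    and denom_f: "\<And>i z. i \<ge> 1 \<Longrightarrow> z \<in> U \<Longrightarrow> f (x i) z \<noteq> 0"
    and "b \<longlonglongrightarrow> blim" and "blim \<in> \<Omega>"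
    and "uniform_limit U (\<lambda>n z. \<Sum>k\<le>n. fg_term f g b x F k z) S sequentially"
    and "\<And>i. (\<lambda>z. g (b i) z / f (x (i + 1)) z) analytic_on {blim}"
  shows "\<exists>\<Omega>\<^sub>1. open \<Omega>\<^sub>1 \<and> \<Omega>\<^sub>1 \<subseteq> \<Omega> \<and> blim \<in> \<Omega>\<^sub>1 \<and>
           (\<forall>z\<in>\<Omega>\<^sub>1. F z = S z \<and> (\<lambda>k. fg_term f g b x F k z) sums S z)"
proof -
  note lim = \<open>uniform_limit U (\<lambda>n z. \<Sum>k\<le>n. fg_term f g b x F k z) S sequentially\<close>
  note ker = \<open>antisymmetric g\<close> \<open>f \<in> Ker_L3 g\<close>
  have sums: "(\<lambda>k. fg_term f g b x F k z) sums S z" if "z \<in> U" for z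
    using tendsto_uniform_limitI[OF lim that] by (simp add: sums_def_le)
  obtain W where W: "open W" "blim \<in> W" "W \<subseteq> U"
      and ratio: "\<And>i. (\<lambda>z. g (b i) z / f (x (i + 1)) z) holomorphic_on W"
    using ratios_common_domain[of g f b U "\<lambda>i. x (i + 1)" blim] ker denom_g denom_f
      \<open>open U\<close> \<open>blim \<in> U\<close> assms(15) by (metis le_add2)
  \<comment> \<open>The identity theorem needs a connected domain.\<close>
  obtain e where e: "e > 0" "ball blim e \<subseteq> W \<inter> \<Omega>"
    using open_contains_ball W \<open>open \<Omega>\<close> \<open>blim \<in> \<Omega>\<close> by (metis IntI open_Int)
  let ?B = "ball blim e"
  have BU: "?B \<subseteq> U" using e W by auto
  have hol_term: "fg_term f g b x F k holomorphic_on ?B" for k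
  proof -
    have "(\<lambda>z. g (b i) z / f (x (i + 1)) z) holomorphic_on ?B" for i
      using ratio by (rule holomorphic_on_subset) (use e in auto)
    then show ?thesis
      unfolding fg_term_eq_prod_ratios
      by (intro holomorphic_on_mult holomorphic_on_const holomorphic_on_prod)
  qed
  have "S holomorphic_on ?B"
  proof (rule holomorphic_uniform_sequence)
    show "(\<lambda>z. \<Sum>k\<le>n. fg_term f g b x F k z) holomorphic_on ?B" for n
      by (intro holomorphic_intros hol_term)
    fix z assume "z \<in> ?B"
    then obtain d where "d > 0" "cball z d \<subseteq> ?B"
      using open_contains_cball by blast
    moreover from this BU have
      "uniform_limit (cball z d) (\<lambda>n z. \<Sum>k\<le>n. fg_term f g b x F k z) S sequentially"
      by (intro uniform_limit_on_subset[OF lim]) auto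
    ultimately show "\<exists>d>0. cball z d \<subseteq> ?B \<and>
        uniform_limit (cball z d) (\<lambda>n z. \<Sum>k\<le>n. fg_term f g b x F k z) S sequentially"
      by blast
  qed auto
  moreover have "F holomorphic_on ?B"
    using analytic_imp_holomorphic[OF \<open>F analytic_on \<Omega>\<close>]
    by (rule holomorphic_on_subset) (use e in auto)
  ultimately have hol: "(\<lambda>z. F z - S z) holomorphic_on ?B"
    by (intro holomorphic_intros)
  have node: "F (b m) - S (b m) = 0" if "b m \<in> ?B" for m
  proof -
    have "b m \<in> U" using that BU by blast
    then have "(\<Sum>k\<le>n. fg_term f g b x F k (b m)) = F (b m)" if "m \<le> n" for n
      using that denom_f by (intro fg_partial_sum_interpolates[where b = b and x = x, OF ker denom_g denom_f0]) auto
    then have "(\<lambda>n. \<Sum>k\<le>n. fg_term f g b x F k (b m)) \<longlonglongrightarrow> F (b m)"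
      by (intro tendsto_eventually eventually_sequentiallyI[of m]) auto
    moreover have "(\<lambda>n. \<Sum>k\<le>n. fg_term f g b x F k (b m)) \<longlonglongrightarrow> S (b m)"
      using sums[OF \<open>b m \<in> U\<close>] by (simp add: sums_def_le)
    ultimately show ?thesis
      using LIMSEQ_unique by fastforce
  qed
  have "eventually (\<lambda>n. b n \<in> ?B) sequentially"
    using \<open>b \<longlonglongrightarrow> blim\<close> e(1) by (intro topological_tendstoD) auto
  then obtain N where "\<And>n. n \<ge> N \<Longrightarrow> b n \<in> ?B"
    by (auto simp: eventually_sequentially)
  then have "blim islimpt (range b \<inter> ?B)"
    by (intro inj_tendsto_islimpt[OF \<open>inj b\<close> \<open>b \<longlonglongrightarrow> blim\<close>, of N]) auto
  then have "F z - S z = 0" if "z \<in> ?B" for z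
    using analytic_continuation[OF hol, of "range b \<inter> ?B" blim z] node e(1) that by auto
  then show ?thesis
    using e BU sums by (intro exI[of _ ?B]) auto
qed

end
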